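(* Let $\alpha\in(0,1)$, $D=(0,1)$. Assume that the deterministic function $F$ belongs to $H^1(\mathbb R_+)$, and let $U(x,\omega)=-\hat F(\omega)\int_Dg_\omega(x,y)\,dW_y$ be the mild solution of \[ \begin{cases} \partial_{xx}U(x,\omega)-(\mathrm i\omega)^\alpha U(x,\omega)=-\hat F(\omega)\dot W_x, & x\in D,\ \omega\in\mathbb R,\\ \partial_xU(0,\omega)=0,\quad U(1,\omega)=0, & \omega\in\mathbb R. \end{cases} \] Then the modulus $|\hat F(\omega)|$ is uniquely determined by the data $\mathbb V[U(0,\omega)]$. That is, if $F_1,F_2\in H^1(\mathbb R_+)$ have corresponding mild solutions $U_1,U_2$, then for each $\omega$ (at which $\hat F_1(\omega),\hat F_2(\omega)$ are defined), $\mathbb V[U_1(0,\omega)]=\mathbb V[U_2(0,\omega)]$ implies $|\hat F_1(\omega)|=|\hat F_2(\omega)|$.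
   Context: $W$ is a standard one-dimensional (spatial) Brownian motion on $[0,1]$, $\dot W_x$ is its formal derivative (white noise), and $\int_D\cdot\,dW_y$ is the Itô (Wiener) integral. $\hat F(\omega)=\int_{\mathbb R}e^{-\mathrm i\omega t}\tilde F(t)\,dt$, where $\tilde F$ is the extension of $F$ by zero to $(-\infty,0)$. For a complex random variable $Z$, $\mathbb V[Z]=\mathbb E|Z-\mathbb E Z|^2$. Convention: $(\mathrm i\omega)^\beta=|\omega|^\beta\exp\left(\frac{\mathrm i\pi\beta}{2}\operatorname{sgn}(\omega)\right)$ for $\omega\ne0$, and $(\mathrm i\omega)^\beta=0$ for $\omega=0$. $g_\omega$ is the Green function of the boundary value problem: with $\sqrt s:=(\mathrm i\omega)^{\alpha/2}$, for $\omega\ne0$, \[ g_\omega(x,y)=\frac{e^{\sqrt s(x+y)}+e^{\sqrt s|x-y|}-e^{\sqrt s(2-x-y)}-e^{\sqrt s(2-|x-y|)}}{2\sqrt s\,(1+e^{2\sqrt s})}, \] and $g_0(x,y)=\max\{x,y\}-1$. In particular $g_\omega(0,y)=\dfrac{e^{\sqrt s y}-e^{\sqrt s(2-y)}}{\sqrt s(1+e^{2\sqrt s})}$ for $\omega\neq0$ and $g_0(0,y)=y-1$. *)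

theory Defs
  imports "HOL-Probability.Probability"
begin

definition subdivision :: "nat \<Rightarrow> (nat \<Rightarrow> real) \<Rightarrow> bool" where
  "subdivision n t \<longleftrightarrow> 0 \<le> t 0 \<and> (\<forall>i<n. t i < t (Suc i)) \<and> t n \<le> 1"

definition brownian_motion01 :: "'a measure \<Rightarrow> (real \<Rightarrow> 'a \<Rightarrow> real) \<Rightarrow> bool" where
  "brownian_motion01 M W \<longleftrightarrow>
     prob_space M \<and>
     (\<forall>x\<in>{0..1}. W x \<in> borel_measurable M) \<and>
     (AE w in M. W 0 w = 0) \<and>
     (\<forall>x y. 0 \<le> x \<and> x < y \<and> y \<le> 1 \<longrightarrow>
        distributed M lborel (\<lambda>w. W y w - W x w) (normal_density 0 (sqrt (y - x)))) \<and>
     (\<forall>n t. subdivision n t \<longrightarrow>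
        prob_space.indep_vars M (\<lambda>_. borel) (\<lambda>i w. W (t (Suc i)) w - W (t i) w) {..<n}) \<and>
     (AE w in M. continuous_on {0..1} (\<lambda>x. W x w))"

definition step_fun :: "nat \<Rightarrow> (nat \<Rightarrow> real) \<Rightarrow> (nat \<Rightarrow> complex) \<Rightarrow> real \<Rightarrow> complex" where
  "step_fun n t c y = (\<Sum>i<n. c i * indicator {t i<..t (Suc i)} y)"

definition step_integral ::
  "(real \<Rightarrow> 'a \<Rightarrow> real) \<Rightarrow> nat \<Rightarrow> (nat \<Rightarrow> real) \<Rightarrow> (nat \<Rightarrow> complex) \<Rightarrow> 'a \<Rightarrow> complex" where
  "step_integral W n t c w = (\<Sum>i<n. c i * complex_of_real (W (t (Suc i)) w - W (t i) w))"

text \<open>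
  The Wiener integral of a deterministic integrand over \<open>(0,1)\<close> is the \<open>L\<^sup>2\<close>-limit of the
  integrals of step functions approximating the integrand in \<open>L\<^sup>2(0,1)\<close>.  It is determined only
  up to null sets, so it is stated as a relation: \<open>I\<close> is a version of the integral of \<open>f\<close>.
\<close>

definition has_wiener_integral ::
  "'a measure \<Rightarrow> (real \<Rightarrow> 'a \<Rightarrow> real) \<Rightarrow> (real \<Rightarrow> complex) \<Rightarrow> ('a \<Rightarrow> complex) \<Rightarrow> bool" where
  "has_wiener_integral M W f I \<longleftrightarrow>
     set_borel_measurable lebesgue {0<..<1} f \<and> I \<in> borel_measurable M \<and>
     (\<exists>n t c. (\<forall>k. subdivision (n k) (t k)) \<and>
        (\<lambda>k. \<integral>\<^sup>+y\<in>{0<..<1}. ennreal ((cmod (f y - step_fun (n k) (t k) (c k) y))\<^sup>2) \<partial>lebesgue)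
          \<longlonglongrightarrow> 0 \<and>
        (\<lambda>k. \<integral>\<^sup>+w. ennreal ((cmod (I w - step_integral W (n k) (t k) (c k) w))\<^sup>2) \<partial>M)
          \<longlonglongrightarrow> 0)"

definition complex_variance :: "'a measure \<Rightarrow> ('a \<Rightarrow> complex) \<Rightarrow> real" where
  "complex_variance M Z = (LINT w|M. (cmod (Z w - (LINT v|M. Z v)))\<^sup>2)"

definition test_function_pos :: "(real \<Rightarrow> real) \<Rightarrow> bool" where
  "test_function_pos \<phi> \<longleftrightarrow>
     (\<forall>n x. ((deriv ^^ n) \<phi>) field_differentiable (at x)) \<and>
     (\<exists>a b. 0 < a \<and> a \<le> b \<and> (\<forall>x. x \<notin> {a..b} \<longrightarrow> \<phi> x = 0))"

definition L2_pos :: "(real \<Rightarrow> complex) set" where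
  "L2_pos = {F. set_borel_measurable lebesgue {0<..} F \<and>
                set_integrable lebesgue {0<..} (\<lambda>t. (cmod (F t))\<^sup>2)}"

definition weak_deriv_pos :: "(real \<Rightarrow> complex) \<Rightarrow> (real \<Rightarrow> complex) \<Rightarrow> bool" where
  "weak_deriv_pos F G \<longleftrightarrow>
     (\<forall>\<phi>. test_function_pos \<phi> \<longrightarrow>
        (LINT t:{0<..}|lebesgue. complex_of_real (deriv \<phi> t) * F t) =
        - (LINT t:{0<..}|lebesgue. complex_of_real (\<phi> t) * G t))"

definition H1_pos :: "(real \<Rightarrow> complex) set" where
  "H1_pos = {F \<in> L2_pos. \<exists>G\<in>L2_pos. weak_deriv_pos F G}"

definition zero_ext :: "(real \<Rightarrow> complex) \<Rightarrow> real \<Rightarrow> complex" where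
  "zero_ext F t = (if t < 0 then 0 else F t)"

text \<open>
  An \<open>H\<^sup>1\<close> function on the half-line need not be integrable, so the integral over the whole line
  is read as the limit of the integrals over \<open>[-R,R]\<close>.  For integrable functions this is the
  Lebesgue integral, and in general, wherever the limit exists, it agrees almost everywhere with
  the Plancherel transform.
\<close>

definition has_fourier :: "(real \<Rightarrow> complex) \<Rightarrow> real \<Rightarrow> complex \<Rightarrow> bool" where
  "has_fourier F \<omega> z \<longleftrightarrow>
     ((\<lambda>R. LINT t:{-R..R}|lebesgue. exp (- \<i> * complex_of_real \<omega> * complex_of_real t) * zero_ext F t)
        \<longlongrightarrow> z) at_top"

definition fourier_defined :: "(real \<Rightarrow> complex) \<Rightarrow> real \<Rightarrow> bool" where
  "fourier_defined F \<omega> \<longleftrightarrow> (\<exists>z. has_fourier F \<omega> z)"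

definition fourier :: "(real \<Rightarrow> complex) \<Rightarrow> real \<Rightarrow> complex" where
  "fourier F \<omega> = (THE z. has_fourier F \<omega> z)"

lemma fourier_eqI: "has_fourier F \<omega> z \<Longrightarrow> fourier F \<omega> = z"
  unfolding fourier_def has_fourier_def
  by (intro the_equality) (auto intro: tendsto_unique[OF trivial_limit_at_top_linorder])

definition iomega_pow :: "real \<Rightarrow> real \<Rightarrow> complex" where
  "iomega_pow \<omega> \<beta> =
     (if \<omega> = 0 then 0
      else complex_of_real (\<bar>\<omega>\<bar> powr \<beta>) * exp (\<i> * complex_of_real (pi * \<beta> / 2 * sgn \<omega>)))"

lemma iomega_pow_eq_powr:
  "iomega_pow \<omega> \<beta> = (\<i> * complex_of_real \<omega>) powr complex_of_real \<beta>"
proof (cases "\<omega> = 0")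
  case False
  have "Ln (\<i> * complex_of_real \<omega>) = complex_of_real (ln \<bar>\<omega>\<bar>) + \<i> * complex_of_real (pi / 2 * sgn \<omega>)"
  proof (rule Ln_unique)
    have "exp (\<i> * complex_of_real (pi / 2 * sgn \<omega>)) = \<i> * complex_of_real (sgn \<omega>)"
      using False by (auto simp: sgn_if complex_eq_iff Re_exp Im_exp)
    then show "exp (complex_of_real (ln \<bar>\<omega>\<bar>) + \<i> * complex_of_real (pi / 2 * sgn \<omega>)) =
        \<i> * complex_of_real \<omega>"
      using False by (simp add: exp_add exp_of_real sgn_if split: if_splits)
  qed (use False in \<open>auto simp: sgn_if\<close>)
  then show ?thesis
    using False by (simp add: iomega_pow_def powr_def exp_add[symmetric] exp_of_real[symmetric]
        algebra_simps)
qed (simp add: iomega_pow_def)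

definition green :: "real \<Rightarrow> real \<Rightarrow> real \<Rightarrow> real \<Rightarrow> complex" where
  "green \<alpha> \<omega> x y =
     (if \<omega> = 0 then complex_of_real (max x y - 1)
      else let r = iomega_pow \<omega> (\<alpha> / 2) in
        (exp (r * complex_of_real (x + y)) + exp (r * complex_of_real \<bar>x - y\<bar>)
          - exp (r * complex_of_real (2 - x - y)) - exp (r * complex_of_real (2 - \<bar>x - y\<bar>)))
        / (2 * r * (1 + exp (2 * r))))"

lemma green_at_0:
  assumes "0 \<le> y"
  shows "green \<alpha> \<omega> 0 y =
     (if \<omega> = 0 then complex_of_real (y - 1)
      else let r = iomega_pow \<omega> (\<alpha> / 2) in
        (exp (r * complex_of_real y) - exp (r * complex_of_real (2 - y))) / (r * (1 + exp (2 * r))))"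
proof -
  have *: "(2 * a - 2 * b) / (2 * r * d) = (a - b) / (r * d)" for a b r d :: complex
    using mult_divide_mult_cancel_left[of 2 "a - b" "r * d"] by (simp add: algebra_simps)
  show ?thesis
    using assms by (simp add: green_def Let_def * del: of_real_diff)
qed

text \<open>
  As the stochastic integral is determined only up to null sets, the equality defining the mild
  solution holds almost surely for each \<open>x\<close> and \<open>\<omega>\<close>.  Nothing is required at
  frequencies where the Fourier transform of \<open>F\<close> is undefined.
\<close>

definition mild_solution ::
  "'a measure \<Rightarrow> (real \<Rightarrow> 'a \<Rightarrow> real) \<Rightarrow> real \<Rightarrow> (real \<Rightarrow> complex) \<Rightarrow>
   (real \<Rightarrow> real \<Rightarrow> 'a \<Rightarrow> complex) \<Rightarrow> bool" where
  "mild_solution M W \<alpha> F U \<longleftrightarrow>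
     (\<forall>x\<in>{0..1}. \<forall>\<omega>. fourier_defined F \<omega> \<longrightarrow>
        U x \<omega> \<in> borel_measurable M \<and>
        (\<exists>I. has_wiener_integral M W (green \<alpha> \<omega> x) I \<and>
             (AE w in M. U x \<omega> w = - fourier F \<omega> * I w)))"

end

theory Submission
  imports Defs
begin

text \<open>
  By the Ito isometry the variance of \<open>U(0,\<omega>)\<close> is the product of the squared modulus of the
  Fourier transform of \<open>F\<close> at \<open>\<omega>\<close> and the integral of \<open>|g\<^sub>\<omega>(0,y)|\<^sup>2\<close> over \<open>(0,1)\<close>.  That integral
  does not depend on \<open>F\<close>, and it is positive because \<open>g\<^sub>\<omega>(0,y)\<close> vanishes nowhere on \<open>(0,1)\<close>: for
  \<open>\<omega> \<noteq> 0\<close> one has \<open>Re \<surd>s > 0\<close>, hence \<open>|exp(\<surd>s y)| < |exp(\<surd>s (2 - y))|\<close> for \<open>y < 1\<close>, and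
  \<open>g\<^sub>0(0,y) = y - 1\<close>.
\<close>

section \<open>Square-integrable functions: orthogonal sums and limits in mean square\<close>

text \<open>Expanding the squared modulus into a double sum leaves only the diagonal after
  integration. The measure is arbitrary so that the lemma covers both sides of the isometry:
  indicators of disjoint intervals under Lebesgue measure, and Brownian increments under the
  probability measure. In both cases \<open>v i\<close> is the length of the i-th interval.\<close>

lemma integral_norm_sum_orthogonal:
  fixes X :: "nat \<Rightarrow> 'a \<Rightarrow> real" and c :: "nat \<Rightarrow> complex"
  assumes int: "\<And>i j. i < n \<Longrightarrow> j < n \<Longrightarrow> integrable M (\<lambda>w. X i w * X j w)"
    and orth: "\<And>i j. i < n \<Longrightarrow> j < n \<Longrightarrow> i \<noteq> j \<Longrightarrow> (\<integral>w. X i w * X j w \<partial>M) = 0"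
    and v: "\<And>i. i < n \<Longrightarrow> (\<integral>w. X i w * X i w \<partial>M) = v i"
  shows "integrable M (\<lambda>w. (cmod (\<Sum>i<n. c i * complex_of_real (X i w)))\<^sup>2)"
    and "(\<integral>w. (cmod (\<Sum>i<n. c i * complex_of_real (X i w)))\<^sup>2 \<partial>M) = (\<Sum>i<n. (cmod (c i))\<^sup>2 * v i)"
proof -
  have expand: "(cmod (\<Sum>i<n. c i * complex_of_real (X i w)))\<^sup>2 =
      (\<Sum>i<n. \<Sum>j<n. Re (c i * cnj (c j)) * (X i w * X j w))" for w
  proof -
    \<comment> \<open>The identity |z|^2 = z * cnj z turns the squared modulus into a product of two
      sums. It lives in the complex numbers, so real parts are taken afterwards.\<close>
    have "complex_of_real ((cmod (\<Sum>i<n. c i * complex_of_real (X i w)))\<^sup>2) =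
        (\<Sum>i<n. \<Sum>j<n. (c i * cnj (c j)) * complex_of_real (X i w * X j w))"
      unfolding complex_norm_square cnj_sum sum_product by (simp add: mult_ac)
    then have "Re (complex_of_real ((cmod (\<Sum>i<n. c i * complex_of_real (X i w)))\<^sup>2)) =
        Re (\<Sum>i<n. \<Sum>j<n. (c i * cnj (c j)) * complex_of_real (X i w * X j w))"
      by (rule arg_cong)
    then show ?thesis
      by simp
  qed
  have int_term: "integrable M (\<lambda>w. a * (X i w * X j w))" if "i < n" "j < n" for a i j
    using int[OF that] by (rule integrable_mult_right)
  have int_row: "integrable M (\<lambda>w. \<Sum>j<n. Re (c i * cnj (c j)) * (X i w * X j w))" if "i < n" for i
    using that by (intro Bochner_Integration.integrable_sum int_term) simp_all
  show "integrable M (\<lambda>w. (cmod (\<Sum>i<n. c i * complex_of_real (X i w)))\<^sup>2)"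
    unfolding expand by (rule Bochner_Integration.integrable_sum) (rule int_row, simp)
  have "(\<integral>w. (cmod (\<Sum>i<n. c i * complex_of_real (X i w)))\<^sup>2 \<partial>M) =
      (\<Sum>i<n. \<integral>w. (\<Sum>j<n. Re (c i * cnj (c j)) * (X i w * X j w)) \<partial>M)"
    unfolding expand by (rule Bochner_Integration.integral_sum) (rule int_row, simp)
  also have "\<dots> = (\<Sum>i<n. \<Sum>j<n. \<integral>w. Re (c i * cnj (c j)) * (X i w * X j w) \<partial>M)"
    by (intro sum.cong refl Bochner_Integration.integral_sum int_term) auto
  also have "\<dots> = (\<Sum>i<n. \<Sum>j<n. if i = j then (cmod (c i))\<^sup>2 * v i else 0)"
    by (intro sum.cong refl) (auto simp: orth v cmod_def power2_eq_square)
  finally show "(\<integral>w. (cmod (\<Sum>i<n. c i * complex_of_real (X i w)))\<^sup>2 \<partial>M) = (\<Sum>i<n. (cmod (c i))\<^sup>2 * v i)"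
    by simp
qed

text \<open>Factor the difference of squares, bound the factors by the triangle inequality, and
  split the mixed term by Young's inequality with weight \<epsilon>. The right-hand side can be
  integrated term by term, so convergence of norms follows without the Cauchy-Schwarz
  inequality.\<close>

lemma cmod_square_diff_le:
  assumes "0 < \<epsilon>"
  shows "\<bar>(cmod s)\<^sup>2 - (cmod f)\<^sup>2\<bar> \<le> (1 + 1 / \<epsilon>) * (cmod (f - s))\<^sup>2 + \<epsilon> * (cmod f)\<^sup>2"
proof -
  let ?a = "cmod f" and ?b = "cmod s" and ?d = "cmod (f - s)"
  have "\<bar>?b - ?a\<bar> \<le> ?d"
    by (metis abs_minus_commute norm_triangle_ineq3)
  moreover have "\<bar>?b\<^sup>2 - ?a\<^sup>2\<bar> = \<bar>?b - ?a\<bar> * (?b + ?a)"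
    by (simp add: power2_eq_square square_diff_square_factored abs_mult mult.commute)
  moreover have "?b + ?a \<le> ?d + 2 * ?a"
    using calculation(1) by linarith
  ultimately have "\<bar>?b\<^sup>2 - ?a\<^sup>2\<bar> \<le> ?d * (?d + 2 * ?a)"
    by (simp add: mult_mono)
  also have "\<dots> = ?d\<^sup>2 + 2 * ?d * ?a"
    by (simp add: power2_eq_square algebra_simps)
  also have "2 * ?d * ?a \<le> ?d\<^sup>2 / \<epsilon> + \<epsilon> * ?a\<^sup>2"
  proof -
    \<comment> \<open>Young's inequality, obtained by expanding a nonnegative square.\<close>
    have "0 \<le> (?d - \<epsilon> * ?a)\<^sup>2 / \<epsilon>"
      using assms by simp
    also have "\<dots> = ?d\<^sup>2 / \<epsilon> + \<epsilon> * ?a\<^sup>2 - 2 * ?d * ?a"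
      using assms by (simp add: power2_eq_square field_simps)
    finally show ?thesis by simp
  qed
  finally show ?thesis
    by (simp add: algebra_simps)
qed

text \<open>One approximant at finite distance from \<open>f\<close> already makes \<open>f\<close>
  square integrable. All integrals are then finite, and the pointwise bound above carries the
  convergence over to the squared norms.\<close>

lemma L2_limit:
  fixes f :: "'a \<Rightarrow> complex" and s :: "nat \<Rightarrow> 'a \<Rightarrow> complex"
  assumes f [measurable]: "f \<in> borel_measurable M"
    and s [measurable]: "\<And>k. s k \<in> borel_measurable M"
    and s2: "\<And>k. integrable M (\<lambda>w. (cmod (s k w))\<^sup>2)"
    and lim: "(\<lambda>k. \<integral>\<^sup>+w. ennreal ((cmod (f w - s k w))\<^sup>2) \<partial>M) \<longlonglongrightarrow> 0"
  shows L2_limit_integrable: "integrable M (\<lambda>w. (cmod (f w))\<^sup>2)"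
    and L2_limit_integrable_diff: "integrable M (\<lambda>w. (cmod (f w - s k w))\<^sup>2)"
    and L2_limit_diff: "(\<lambda>k. \<integral>w. (cmod (f w - s k w))\<^sup>2 \<partial>M) \<longlonglongrightarrow> 0"
    and L2_limit_norm: "(\<lambda>k. \<integral>w. (cmod (s k w))\<^sup>2 \<partial>M) \<longlonglongrightarrow> (\<integral>w. (cmod (f w))\<^sup>2 \<partial>M)"
proof -
  have two: "(cmod (x + y))\<^sup>2 \<le> 2 * (cmod x)\<^sup>2 + 2 * (cmod y)\<^sup>2" for x y
  proof -
    have "(cmod (x + y))\<^sup>2 \<le> (cmod x + cmod y)\<^sup>2"
      by (intro power_mono norm_triangle_ineq) simp
    also have "\<dots> \<le> 2 * (cmod x)\<^sup>2 + 2 * (cmod y)\<^sup>2"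
      using zero_le_power2[of "cmod x - cmod y"] by (simp add: power2_eq_square algebra_simps)
    finally show ?thesis .
  qed
  \<comment> \<open>Any finite bound would serve here; 1 is a convenient choice.\<close>
  have "eventually (\<lambda>k. (\<integral>\<^sup>+w. ennreal ((cmod (f w - s k w))\<^sup>2) \<partial>M) < 1) sequentially"
    using lim by (rule order_tendstoD) simp
  then obtain k0 where k0: "(\<integral>\<^sup>+w. ennreal ((cmod (f w - s k0 w))\<^sup>2) \<partial>M) < 1"
    by (auto simp: eventually_sequentially)
  have d0: "integrable M (\<lambda>w. (cmod (f w - s k0 w))\<^sup>2)"
    by (rule integrableI_nonneg) (use k0 in \<open>auto intro: less_trans\<close>)
  show f2: "integrable M (\<lambda>w. (cmod (f w))\<^sup>2)"
  proof (rule Bochner_Integration.integrable_bound)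
    show "integrable M (\<lambda>w. 2 * (cmod (f w - s k0 w))\<^sup>2 + 2 * (cmod (s k0 w))\<^sup>2)"
      using d0 s2 by auto
    show "AE w in M. norm ((cmod (f w))\<^sup>2) \<le> norm (2 * (cmod (f w - s k0 w))\<^sup>2 + 2 * (cmod (s k0 w))\<^sup>2)"
      using two[of "f w - s k0 w" "s k0 w" for w] by simp
  qed simp
  show d2: "integrable M (\<lambda>w. (cmod (f w - s k w))\<^sup>2)" for k
  proof (rule Bochner_Integration.integrable_bound)
    show "integrable M (\<lambda>w. 2 * (cmod (f w))\<^sup>2 + 2 * (cmod (s k w))\<^sup>2)"
      using f2 s2 by auto
    show "AE w in M. norm ((cmod (f w - s k w))\<^sup>2) \<le> norm (2 * (cmod (f w))\<^sup>2 + 2 * (cmod (s k w))\<^sup>2)"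
      using two[of "f w" "- s k w" for w] by simp
  qed simp
  have "(\<lambda>k. ennreal (\<integral>w. (cmod (f w - s k w))\<^sup>2 \<partial>M)) \<longlonglongrightarrow> ennreal 0"
    using lim d2 by (simp add: nn_integral_eq_integral)
  then show D: "(\<lambda>k. \<integral>w. (cmod (f w - s k w))\<^sup>2 \<partial>M) \<longlonglongrightarrow> 0"
    by (subst (asm) tendsto_ennreal_iff) auto
  let ?D = "\<lambda>k. \<integral>w. (cmod (f w - s k w))\<^sup>2 \<partial>M" and ?f = "\<integral>w. (cmod (f w))\<^sup>2 \<partial>M"
  have bound: "\<bar>(\<integral>w. (cmod (s k w))\<^sup>2 \<partial>M) - ?f\<bar> \<le> (1 + 1 / \<epsilon>) * ?D k + \<epsilon> * ?f" if "0 < \<epsilon>" for k \<epsilon>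
  proof -
    have "\<bar>(\<integral>w. (cmod (s k w))\<^sup>2 \<partial>M) - ?f\<bar> = \<bar>\<integral>w. (cmod (s k w))\<^sup>2 - (cmod (f w))\<^sup>2 \<partial>M\<bar>"
      using s2 f2 by simp
    also have "\<dots> \<le> (\<integral>w. \<bar>(cmod (s k w))\<^sup>2 - (cmod (f w))\<^sup>2\<bar> \<partial>M)"
      by (rule integral_abs_bound)
    also have "\<dots> \<le> (\<integral>w. (1 + 1 / \<epsilon>) * (cmod (f w - s k w))\<^sup>2 + \<epsilon> * (cmod (f w))\<^sup>2 \<partial>M)"
      using s2 f2 d2 that by (intro integral_mono cmod_square_diff_le) auto
    also have "\<dots> = (1 + 1 / \<epsilon>) * ?D k + \<epsilon> * ?f"
      using f2 d2 by simp
    finally show ?thesis .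
  qed
  show "(\<lambda>k. \<integral>w. (cmod (s k w))\<^sup>2 \<partial>M) \<longlonglongrightarrow> ?f"
  proof (rule tendstoI)
    fix e :: real
    assume "0 < e"
    have "0 \<le> ?f" by simp
    \<comment> \<open>Chosen so that \<epsilon> times the squared norm of \<open>f\<close> is at
      most e/2; the added 1 keeps the denominator positive when that norm is zero.\<close>
    define \<epsilon> where "\<epsilon> = e / (2 * (?f + 1))"
    have "0 < e / (2 * (a + 1)) \<and> e / (2 * (a + 1)) * a \<le> e / 2" if "0 \<le> a" for a
      using \<open>0 < e\<close> that by (simp add: field_simps)
    from this[OF \<open>0 \<le> ?f\<close>] have \<epsilon>: "0 < \<epsilon>" and half: "\<epsilon> * ?f \<le> e / 2"
      by (simp_all only: \<epsilon>_def)
    have "(\<lambda>k. (1 + 1 / \<epsilon>) * ?D k) \<longlonglongrightarrow> (1 + 1 / \<epsilon>) * 0"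
      by (intro tendsto_intros D)
    then have "eventually (\<lambda>k. (1 + 1 / \<epsilon>) * ?D k < e / 2) sequentially"
      by (rule order_tendstoD) (use \<open>0 < e\<close> in simp)
    then show "eventually (\<lambda>k. dist (\<integral>w. (cmod (s k w))\<^sup>2 \<partial>M) ?f < e) sequentially"
    proof eventually_elim
      case (elim k)
      then show ?case
        using bound[OF \<epsilon>, of k] half unfolding dist_real_def by linarith
    qed
  qed
qed

text \<open>The inequality combines |E Z| \<le> E |Z| with the nonnegativity of the variance of |Z|.
  It serves to show that means pass to mean-square limits.\<close>

lemma (in prob_space) cmod_expectation_square_le:
  fixes Z :: "'a \<Rightarrow> complex"
  assumes [measurable]: "Z \<in> borel_measurable M" and Z2: "integrable M (\<lambda>w. (cmod (Z w))\<^sup>2)"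
  shows "integrable M Z" and "(cmod (expectation Z))\<^sup>2 \<le> expectation (\<lambda>w. (cmod (Z w))\<^sup>2)"
proof -
  have Z1: "integrable M (\<lambda>w. cmod (Z w))"
    by (rule square_integrable_imp_integrable) (use Z2 in auto)
  then show "integrable M Z"
    by (simp add: integrable_norm_iff)
  have "(cmod (expectation Z))\<^sup>2 \<le> (expectation (\<lambda>w. cmod (Z w)))\<^sup>2"
    by (intro power_mono integral_norm_bound) simp
  also have "\<dots> \<le> expectation (\<lambda>w. (cmod (Z w))\<^sup>2)"
    using variance_positive[of "\<lambda>w. cmod (Z w)"] variance_eq[OF Z1 Z2] by simp
  finally show "(cmod (expectation Z))\<^sup>2 \<le> expectation (\<lambda>w. (cmod (Z w))\<^sup>2)" .
qed

section \<open>Subdivisions and the norm of step functions\<close>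

lemma subdivision_mono:
  assumes "subdivision n t" "i \<le> j" "j \<le> n"
  shows "t i \<le> t j"
proof -
  have "\<forall>i<n. t i < t (Suc i)" using assms(1) by (simp add: subdivision_def)
  with assms(2,3) show ?thesis
    by (induction j rule: dec_induct) (auto intro: order.trans[OF _ less_imp_le])
qed

lemma subdivision_step:
  assumes "subdivision n t" "i < n"
  shows "0 \<le> t i" "t i < t (Suc i)" "t (Suc i) \<le> 1"
  using assms subdivision_mono[OF assms(1), of 0 i] subdivision_mono[OF assms(1), of "Suc i" n]
  by (auto simp: subdivision_def)

text \<open>The intervals of a subdivision are pairwise disjoint, so their indicators are orthogonal
  and each has squared norm equal to the interval's length.\<close>

lemma step_fun_L2:
  assumes t: "subdivision n t"
  shows "step_fun n t c \<in> borel_measurable (restrict_space lebesgue {0<..<1})"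
    and "integrable (restrict_space lebesgue {0<..<1}) (\<lambda>y. (cmod (step_fun n t c y))\<^sup>2)"
    and "(\<integral>y. (cmod (step_fun n t c y))\<^sup>2 \<partial>restrict_space lebesgue {0<..<1}) =
      (\<Sum>i<n. (cmod (c i))\<^sup>2 * (t (Suc i) - t i))"
proof -
  define L where "L = restrict_space lebesgue {0<..<1::real}"
  have eq: "step_fun n t c = (\<lambda>y. \<Sum>i<n. c i * complex_of_real (indicator {t i<..t (Suc i)} y))"
    by (rule ext) (simp add: step_fun_def indicator_def of_bool_def if_distrib cong: if_cong)
  have ind [measurable]: "indicator {a<..b} \<in> borel_measurable L" for a b :: real
    unfolding L_def by (intro measurable_restrict_space1 borel_measurable_indicator) simp
  show "step_fun n t c \<in> borel_measurable (restrict_space lebesgue {0<..<1})"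
    unfolding eq L_def[symmetric] by measurable
  have disj: "indicator {t i<..t (Suc i)} y * indicator {t j<..t (Suc j)} y = (0::real)"
    if "i < n" "j < n" "i \<noteq> j" for i j y
    using subdivision_mono[OF t, of "Suc i" j] subdivision_mono[OF t, of "Suc j" i] that
    by (cases "i < j") (auto simp: indicator_def)
  have meas_eq: "measure L ({t i<..t (Suc i)} \<inter> {0<..<1}) = t (Suc i) - t i" if "i < n" for i
  proof -
    note ti = subdivision_step[OF t that]
    \<comment> \<open>A half-open interval of the subdivision lies in (0,1], so restricting to (0,1)
      can remove at most the point 1, a null set.\<close>
    have "measure lebesgue ({t i<..t (Suc i)} \<inter> {0<..<1}) = measure lebesgue ({t i<..t (Suc i)} - {1})"
      using ti by (intro arg_cong[where f = "measure lebesgue"]) auto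
    also have "\<dots> = measure lebesgue {t i<..t (Suc i)}"
      by (rule measure_Diff_null_set) auto
    also have "\<dots> = t (Suc i) - t i"
      using ti by simp
    finally show ?thesis
      by (simp add: L_def measure_restrict_space)
  qed
  have fin: "finite_measure L"
    by (rule finite_measureI) (simp add: L_def emeasure_restrict_space)
  have sq: "indicator {t i<..t (Suc i)} y * indicator {t i<..t (Suc i)} y =
      (indicator {t i<..t (Suc i)} y :: real)" for i y
    by (simp add: indicator_def)
  have int: "integrable L (\<lambda>y. indicator {t i<..t (Suc i)} y * indicator {t j<..t (Suc j)} y :: real)" for i j
    by (rule finite_measure.integrable_const_bound[OF fin, where B = 1])
      (auto intro!: borel_measurable_times ind simp: indicator_le_1 mult_le_one)
  have orth: "(\<integral>y. indicator {t i<..t (Suc i)} y * indicator {t j<..t (Suc j)} y \<partial>L) = (0::real)"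
    if "i < n" "j < n" "i \<noteq> j" for i j
    by (simp only: disj[OF that] Bochner_Integration.integral_zero)
  have "(\<integral>y. indicator {t i<..t (Suc i)} y * indicator {t i<..t (Suc i)} y \<partial>L) = (t (Suc i) - t i :: real)"
    if "i < n" for i
    unfolding sq using meas_eq[OF that] by (simp add: L_def space_restrict_space)
  note * = integral_norm_sum_orthogonal[OF int orth this, where c = c]
  show "integrable (restrict_space lebesgue {0<..<1}) (\<lambda>y. (cmod (step_fun n t c y))\<^sup>2)"
    and "(\<integral>y. (cmod (step_fun n t c y))\<^sup>2 \<partial>restrict_space lebesgue {0<..<1}) =
      (\<Sum>i<n. (cmod (c i))\<^sup>2 * (t (Suc i) - t i))"
    unfolding eq L_def[symmetric] using * by simp_all
qed

section \<open>Brownian increments and integrals of step functions\<close>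

lemma brownian_increment:
  assumes W: "brownian_motion01 M W" and xy: "0 \<le> x" "x < y" "y \<le> 1"
  shows "(\<lambda>w. W y w - W x w) \<in> borel_measurable M"
    and "integrable M (\<lambda>w. W y w - W x w)"
    and "(\<integral>w. W y w - W x w \<partial>M) = 0"
    and "integrable M (\<lambda>w. (W y w - W x w)\<^sup>2)"
    and "(\<integral>w. (W y w - W x w)\<^sup>2 \<partial>M) = y - x"
proof -
  interpret prob_space M using W by (simp add: brownian_motion01_def)
  have D: "distributed M lborel (\<lambda>w. W y w - W x w) (normal_density 0 (sqrt (y - x)))"
    using W xy by (simp add: brownian_motion01_def)
  have pos: "0 < sqrt (y - x)" using xy by simp
  show meas: "(\<lambda>w. W y w - W x w) \<in> borel_measurable M"
    using distributed_measurable[OF D] by simp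
  show E: "(\<integral>w. W y w - W x w \<partial>M) = 0"
    by (rule normal_distributed_expectation[OF pos D])
  have "variance (\<lambda>w. W y w - W x w) = y - x"
    using normal_distributed_variance[OF pos D] xy by simp
  then show V: "(\<integral>w. (W y w - W x w)\<^sup>2 \<partial>M) = y - x"
    by (subst (asm) variance_mean_zero[OF E])
  \<comment> \<open>A non-integrable function has integral 0 by convention, whereas this integral
    equals y - x > 0.\<close>
  with xy show I: "integrable M (\<lambda>w. (W y w - W x w)\<^sup>2)"
    using not_integrable_integral_eq by fastforce
  show "integrable M (\<lambda>w. W y w - W x w)"
    by (rule square_integrable_imp_integrable[OF meas I])
qed

text \<open>Independent centred increments are orthogonal, and their variances are the interval
  lengths. The resulting sum is the one in \<open>step_fun_L2\<close>, which is the Ito isometry for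
  step functions.\<close>

lemma step_integral_L2:
  assumes W: "brownian_motion01 M W" and t: "subdivision n t"
  shows "step_integral W n t c \<in> borel_measurable M"
    and "integrable M (\<lambda>w. (cmod (step_integral W n t c w))\<^sup>2)"
    and "(\<integral>w. step_integral W n t c w \<partial>M) = 0"
    and "(\<integral>w. (cmod (step_integral W n t c w))\<^sup>2 \<partial>M) = (\<Sum>i<n. (cmod (c i))\<^sup>2 * (t (Suc i) - t i))"
proof -
  interpret prob_space M using W by (simp add: brownian_motion01_def)
  define X where "X i w = W (t (Suc i)) w - W (t i) w" for i w
  have eq: "step_integral W n t c = (\<lambda>w. \<Sum>i<n. c i * complex_of_real (X i w))"
    by (rule ext) (simp add: step_integral_def X_def)
  note X = brownian_increment[OF W subdivision_step[OF t], folded X_def]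
  have intX: "integrable M (\<lambda>w. complex_of_real (X i w))" if "i < n" for i
    using X(2)[OF that that that] by simp
  then show "step_integral W n t c \<in> borel_measurable M"
    unfolding eq by (intro borel_measurable_sum borel_measurable_times borel_measurable_const)
      (auto dest: borel_measurable_integrable)
  have E: "(\<integral>w. X i w \<partial>M) = 0" if "i < n" for i
    using X(3)[OF that that that] by simp
  show "(\<integral>w. step_integral W n t c w \<partial>M) = 0"
    unfolding eq by (subst Bochner_Integration.integral_sum) (auto simp: E intX)
  have indep: "indep_vars (\<lambda>_. borel) X {..<n}"
    using W t unfolding brownian_motion01_def X_def[abs_def] by blast
  have prod: "integrable M (\<lambda>w. X i w * X j w) \<and> (\<integral>w. X i w * X j w \<partial>M) = 0"
    if "i < n" "j < n" "i \<noteq> j" for i j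
  proof -
    have ind: "indep_vars (\<lambda>_. borel) X {i, j}"
      using indep that by (auto intro: indep_vars_subset)
    have int: "integrable M (X k)" if "k \<in> {i, j}" for k
      using that \<open>i < n\<close> \<open>j < n\<close> X(2) by auto
    \<comment> \<open>By independence the expectation of the product factors into a product of
      vanishing means.\<close>
    show ?thesis
      using indep_vars_lebesgue_integral[OF _ ind int] indep_vars_integrable[OF _ ind int]
        that X(3) by simp
  qed
  have int: "integrable M (\<lambda>w. X i w * X j w)" if "i < n" "j < n" for i j
    using prod[of i j] that X(4)[of i] by (cases "i = j") (auto simp: power2_eq_square)
  have "(\<integral>w. X i w * X i w \<partial>M) = t (Suc i) - t i" if "i < n" for i
    using X(5)[OF that that that] by (simp add: power2_eq_square)
  note * = integral_norm_sum_orthogonal[OF int _ this, where c = c]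
  show "integrable M (\<lambda>w. (cmod (step_integral W n t c w))\<^sup>2)"
    and "(\<integral>w. (cmod (step_integral W n t c w))\<^sup>2 \<partial>M) = (\<Sum>i<n. (cmod (c i))\<^sup>2 * (t (Suc i) - t i))"
    unfolding eq using * prod by simp_all
qed

section \<open>Mean and isometry of the Wiener integral\<close>

text \<open>The isometry passes from step functions to the limit: both squared norms are limits of
  the same numerical sequence. Square integrability of \<open>f\<close> is a consequence of its
  approximability by step functions.\<close>

lemma wiener_integral_moments:
  assumes W: "brownian_motion01 M W" and I: "has_wiener_integral M W f I"
  shows "f \<in> borel_measurable (restrict_space lebesgue {0<..<1})"
    and "integrable (restrict_space lebesgue {0<..<1}) (\<lambda>y. (cmod (f y))\<^sup>2)"
    and "(\<integral>w. I w \<partial>M) = 0"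
    and "(\<integral>w. (cmod (I w))\<^sup>2 \<partial>M) = (\<integral>y. (cmod (f y))\<^sup>2 \<partial>restrict_space lebesgue {0<..<1})"
proof -
  interpret prob_space M using W by (simp add: brownian_motion01_def)
  let ?L = "restrict_space lebesgue {0<..<1::real}"
  from I obtain n t c where t: "\<And>k. subdivision (n k) (t k)"
    and lim_f: "(\<lambda>k. \<integral>\<^sup>+y\<in>{0<..<1}. ennreal ((cmod (f y - step_fun (n k) (t k) (c k) y))\<^sup>2) \<partial>lebesgue) \<longlonglongrightarrow> 0"
    and lim_I: "(\<lambda>k. \<integral>\<^sup>+w. ennreal ((cmod (I w - step_integral W (n k) (t k) (c k) w))\<^sup>2) \<partial>M) \<longlonglongrightarrow> 0"
    and f: "set_borel_measurable lebesgue {0<..<1} f" and Im [measurable]: "I \<in> borel_measurable M"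
    by (auto simp: has_wiener_integral_def)
  define s where "s k = step_fun (n k) (t k) (c k)" for k
  define S where "S k = step_integral W (n k) (t k) (c k)" for k
  have s: "s k \<in> borel_measurable ?L" "integrable ?L (\<lambda>y. (cmod (s k y))\<^sup>2)"
    "(\<integral>y. (cmod (s k y))\<^sup>2 \<partial>?L) = (\<Sum>i<n k. (cmod (c k i))\<^sup>2 * (t k (Suc i) - t k i))" for k
    unfolding s_def by (rule step_fun_L2[OF t])+
  have S: "S k \<in> borel_measurable M" "integrable M (\<lambda>w. (cmod (S k w))\<^sup>2)" "expectation (S k) = 0"
    "(\<integral>w. (cmod (S k w))\<^sup>2 \<partial>M) = (\<Sum>i<n k. (cmod (c k i))\<^sup>2 * (t k (Suc i) - t k i))" for k
    unfolding S_def by (rule step_integral_L2[OF W t])+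
  show fm: "f \<in> borel_measurable ?L"
    using f by (simp add: borel_measurable_restrict_space_iff set_borel_measurable_def)
  have lim_f': "(\<lambda>k. \<integral>\<^sup>+y. ennreal ((cmod (f y - s k y))\<^sup>2) \<partial>?L) \<longlonglongrightarrow> 0"
    using lim_f by (simp add: nn_integral_restrict_space s_def)
  show "integrable ?L (\<lambda>y. (cmod (f y))\<^sup>2)"
    by (rule L2_limit_integrable[OF fm s(1,2) lim_f'])
  have 1: "(\<lambda>k. \<integral>y. (cmod (s k y))\<^sup>2 \<partial>?L) \<longlonglongrightarrow> (\<integral>y. (cmod (f y))\<^sup>2 \<partial>?L)"
    by (rule L2_limit_norm[OF fm s(1,2) lim_f'])
  note lim_S = Im S(1,2) lim_I[folded S_def]
  have 2: "(\<lambda>k. \<integral>w. (cmod (S k w))\<^sup>2 \<partial>M) \<longlonglongrightarrow> (\<integral>w. (cmod (I w))\<^sup>2 \<partial>M)"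
    by (rule L2_limit_norm[OF lim_S])
  show "(\<integral>w. (cmod (I w))\<^sup>2 \<partial>M) = (\<integral>y. (cmod (f y))\<^sup>2 \<partial>?L)"
    using LIMSEQ_unique[OF 2] 1 by (simp add: s(3) S(4))
  \<comment> \<open>Since \<open>S k\<close> has mean zero, E I = E (I - S k), and this is
    controlled by the mean-square distance, which tends to 0.\<close>
  have "(cmod (expectation I))\<^sup>2 \<le> (\<integral>w. (cmod (I w - S k w))\<^sup>2 \<partial>M)" for k
  proof -
    have "integrable M I"
      by (rule cmod_expectation_square_le(1)[OF Im L2_limit_integrable[OF lim_S]])
    moreover have "integrable M (S k)"
      by (rule cmod_expectation_square_le(1)[OF S(1,2)])
    ultimately have "expectation (\<lambda>w. I w - S k w) = expectation I"
      using S(3) by simp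
    then show ?thesis
      using cmod_expectation_square_le(2)[of "\<lambda>w. I w - S k w"] L2_limit_integrable_diff[OF lim_S] S(1)
      by simp
  qed
  then have "(cmod (expectation I))\<^sup>2 \<le> 0"
    using L2_limit_diff[OF lim_S] by (intro LIMSEQ_le_const) auto
  then show "(\<integral>w. I w \<partial>M) = 0"
    by simp
qed

section \<open>The Green function at the boundary point x = 0\<close>

text \<open>The argument of the power is \<plusminus>\<pi>\<beta>/2, strictly between -\<pi>/2 and
  \<pi>/2, where the cosine is positive.\<close>

lemma Re_iomega_pow_pos:
  assumes "\<omega> \<noteq> 0" "0 < \<beta>" "\<beta> < 1"
  shows "0 < Re (iomega_pow \<omega> \<beta>)"
proof -
  have "0 < cos (pi * \<beta> / 2 * sgn \<omega>)"
    by (rule cos_gt_zero_pi) (use assms in \<open>auto simp: sgn_if field_simps intro: order.strict_trans1[of _ 0]\<close>)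
  then show ?thesis
    using assms by (simp add: iomega_pow_def Re_exp)
qed

text \<open>For \<omega> \<noteq> 0 the denominator has to be treated as well as the numerator,
  because a quotient with denominator 0 has the value 0.\<close>

lemma green_at_0_nonzero:
  assumes "0 < \<alpha>" "\<alpha> < 1" "0 < y" "y < 1"
  shows "green \<alpha> \<omega> 0 y \<noteq> 0"
proof (cases "\<omega> = 0")
  case True
  then have "green \<alpha> \<omega> 0 y = complex_of_real (y - 1)"
    using assms green_at_0[of y \<alpha> \<omega>] by simp
  then show ?thesis
    using assms by (simp only: of_real_eq_0_iff)
next
  case False
  define r where "r = iomega_pow \<omega> (\<alpha> / 2)"
  have r: "0 < Re r"
    unfolding r_def by (rule Re_iomega_pow_pos) (use False assms in auto)
  have "cmod (exp (r * complex_of_real y)) < cmod (exp (r * complex_of_real (2 - y)))"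
    using r assms by (simp del: of_real_diff)
  then have 1: "exp (r * complex_of_real y) - exp (r * complex_of_real (2 - y)) \<noteq> 0"
    by (metis less_irrefl right_minus_eq)
  \<comment> \<open>A number of modulus greater than 1 cannot equal -1.\<close>
  have "1 < cmod (exp (2 * r))"
    using r by simp
  then have 2: "1 + exp (2 * r) \<noteq> 0"
    by (metis add_eq_0_iff2 less_irrefl norm_minus_cancel norm_one)
  have "green \<alpha> \<omega> 0 y = (exp (r * complex_of_real y) - exp (r * complex_of_real (2 - y))) / (r * (1 + exp (2 * r)))"
    using False assms by (simp add: green_at_0 r_def Let_def)
  then show ?thesis
    using 1 2 r by auto
qed

text \<open>If the integral were 0, the integrand would vanish almost everywhere on (0,1). As it
  vanishes nowhere there, (0,1) would be a null set, although its measure is 1.\<close>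

lemma green_at_0_norm_pos:
  assumes "0 < \<alpha>" "\<alpha> < 1"
    and int: "integrable (restrict_space lebesgue {0<..<1}) (\<lambda>y. (cmod (green \<alpha> \<omega> 0 y))\<^sup>2)"
  shows "0 < (\<integral>y. (cmod (green \<alpha> \<omega> 0 y))\<^sup>2 \<partial>restrict_space lebesgue {0<..<1})" (is "0 < ?A")
proof (rule ccontr)
  let ?L = "restrict_space lebesgue {0<..<1::real}"
  assume "\<not> 0 < ?A"
  then have "?A = 0"
    by (simp add: order.antisym)
  then have "AE y in ?L. (cmod (green \<alpha> \<omega> 0 y))\<^sup>2 = 0"
    using int by (subst (asm) integral_nonneg_eq_0_iff_AE) auto
  moreover have "AE y in ?L. y \<in> {0<..<1}"
    by (rule AE_I2) (simp add: space_restrict_space)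
  ultimately have "AE y in ?L. False"
    by eventually_elim (use green_at_0_nonzero[OF assms(1,2)] in auto)
  then have "emeasure ?L (space ?L) = 0"
    by (subst (asm) AE_iff_measurable[OF sets.top]) auto
  then show False
    by (simp add: space_restrict_space emeasure_restrict_space)
qed

section \<open>Variance of the boundary data and recovery of the modulus\<close>

text \<open>The Wiener integral has mean zero, so the variance is a second moment and the isometry
  applies. Integrability of the squared kernel requires no estimate: it follows from the existence
  of the Wiener integral in the definition of a mild solution.\<close>

lemma variance_mild_solution_at_0:
  assumes W: "brownian_motion01 M W" and U: "mild_solution M W \<alpha> F U"
    and F: "fourier_defined F \<omega>"
  shows "integrable (restrict_space lebesgue {0<..<1}) (\<lambda>y. (cmod (green \<alpha> \<omega> 0 y))\<^sup>2)"
    and "complex_variance M (U 0 \<omega>) = (cmod (fourier F \<omega>))\<^sup>2 *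
      (\<integral>y. (cmod (green \<alpha> \<omega> 0 y))\<^sup>2 \<partial>restrict_space lebesgue {0<..<1})"
proof -
  have "U 0 \<omega> \<in> borel_measurable M \<and>
      (\<exists>I. has_wiener_integral M W (green \<alpha> \<omega> 0) I \<and> (AE w in M. U 0 \<omega> w = - fourier F \<omega> * I w))"
    using U F by (simp add: mild_solution_def)
  then obtain I where Um [measurable]: "U 0 \<omega> \<in> borel_measurable M"
    and I: "has_wiener_integral M W (green \<alpha> \<omega> 0) I" and eq: "AE w in M. U 0 \<omega> w = - fourier F \<omega> * I w"
    by blast
  have Im [measurable]: "I \<in> borel_measurable M"
    using I by (simp add: has_wiener_integral_def)
  note mom = wiener_integral_moments[OF W I]
  show "integrable (restrict_space lebesgue {0<..<1}) (\<lambda>y. (cmod (green \<alpha> \<omega> 0 y))\<^sup>2)"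
    by (rule mom)
  have "(\<integral>w. U 0 \<omega> w \<partial>M) = (\<integral>w. - fourier F \<omega> * I w \<partial>M)"
    by (rule integral_cong_AE) (use eq in auto)
  then have E: "(\<integral>w. U 0 \<omega> w \<partial>M) = 0"
    using mom(3) by simp
  have "complex_variance M (U 0 \<omega>) = (\<integral>w. (cmod (U 0 \<omega> w))\<^sup>2 \<partial>M)"
    by (simp add: complex_variance_def E)
  also have "\<dots> = (\<integral>w. (cmod (fourier F \<omega>))\<^sup>2 * (cmod (I w))\<^sup>2 \<partial>M)"
    by (rule integral_cong_AE) (use eq in \<open>auto simp: norm_mult power_mult_distrib\<close>)
  finally show "complex_variance M (U 0 \<omega>) = (cmod (fourier F \<omega>))\<^sup>2 *
      (\<integral>y. (cmod (green \<alpha> \<omega> 0 y))\<^sup>2 \<partial>restrict_space lebesgue {0<..<1})"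
    using mom(4) by simp
qed

theorem theorem4p2:
  fixes \<alpha> :: real
    and M :: "'a measure"
    and W :: "real \<Rightarrow> 'a \<Rightarrow> real"
    and F1 F2 :: "real \<Rightarrow> complex"
    and U1 U2 :: "real \<Rightarrow> real \<Rightarrow> 'a \<Rightarrow> complex"
  assumes "0 < \<alpha>" and "\<alpha> < 1"
    and "brownian_motion01 M W"
    and "F1 \<in> H1_pos" and "F2 \<in> H1_pos"
    and "mild_solution M W \<alpha> F1 U1"
    and "mild_solution M W \<alpha> F2 U2"
  shows "\<forall>\<omega>. fourier_defined F1 \<omega> \<and> fourier_defined F2 \<omega> \<and>
           complex_variance M (U1 0 \<omega>) = complex_variance M (U2 0 \<omega>) \<longrightarrow>
           cmod (fourier F1 \<omega>) = cmod (fourier F2 \<omega>)"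
proof (intro allI impI, elim conjE)
  fix \<omega>
  assume F: "fourier_defined F1 \<omega>" "fourier_defined F2 \<omega>"
    and V: "complex_variance M (U1 0 \<omega>) = complex_variance M (U2 0 \<omega>)"
  note 1 = variance_mild_solution_at_0[OF assms(3,6) F(1)]
  note 2 = variance_mild_solution_at_0[OF assms(3,7) F(2)]
  \<comment> \<open>Both variances carry the same positive factor, the squared norm of the kernel,
    which cancels.\<close>
  have "(cmod (fourier F1 \<omega>))\<^sup>2 = (cmod (fourier F2 \<omega>))\<^sup>2"
    using V green_at_0_norm_pos[OF assms(1,2) 1(1)] unfolding 1(2) 2(2) by simp
  then show "cmod (fourier F1 \<omega>) = cmod (fourier F2 \<omega>)"
    by simp
qed

end
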